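(* Let $c_\star=\frac{\sqrt{13}-1}{6}$. For every $\varepsilon>0$ there exist $\delta>0$ and $n_0\in\mathbb{N}$ such that the following holds for every $n\ge n_0$: if $H$ is a $3$-graph on $n+1$ vertices with minimum vertex degree at least $(c_\star-\delta)\frac{n^2}{2}$, and $x\in V(H)$ is a vertex not contained in any copy of $K_4^{(3)-}$ in $H$, then the link graph $H_x$ can be made bipartite by removing at most $\varepsilon n^2$ edges.
   Context: A $3$-graph is a $3$-uniform hypergraph; the minimum vertex degree is the minimum over vertices $v$ of the number of edges containing $v$. $K_4^{(3)-}$ is the $3$-graph on $4$ vertices with exactly $3$ edges. The link graph $H_x$ of a vertex $x$ is the graph on $V(H)\setminus\{x\}$ whose edges are the pairs $yz$ with $\{x,y,z\}\in E(H)$. *)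

theory Defs
  imports Complex_Main
begin

text \<open>Finite (hyper)graphs are given by a vertex set \<open>V\<close> and a set \<open>E\<close> of edges, each edge being
  the set of its vertices.\<close>

definition uniform_hypergraph :: "nat \<Rightarrow> 'a set \<Rightarrow> 'a set set \<Rightarrow> bool" where
  "uniform_hypergraph k V E \<longleftrightarrow> finite V \<and> (\<forall>e\<in>E. e \<subseteq> V \<and> card e = k)"

abbreviation three_graph :: "'a set \<Rightarrow> 'a set set \<Rightarrow> bool" where
  "three_graph \<equiv> uniform_hypergraph 3"

definition vertex_degree :: "'a set set \<Rightarrow> 'a \<Rightarrow> nat" where
  "vertex_degree E v = card {e \<in> E. v \<in> e}"

text \<open>Only meaningful for finite nonempty \<open>V\<close>.\<close>

definition min_vertex_degree :: "'a set \<Rightarrow> 'a set set \<Rightarrow> nat" where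
  "min_vertex_degree V E = Min (vertex_degree E ` V)"

text \<open>A copy is a not necessarily induced subgraph: an injection of the vertices of \<open>F\<close>
  which maps edges to edges. The copy has vertex set \<open>f ` VF\<close>.\<close>

definition is_copy :: "('b \<Rightarrow> 'a) \<Rightarrow> 'b set \<Rightarrow> 'b set set \<Rightarrow> 'a set \<Rightarrow> 'a set set \<Rightarrow> bool" where
  "is_copy f VF EF V E \<longleftrightarrow> inj_on f VF \<and> f ` VF \<subseteq> V \<and> (\<forall>e\<in>EF. f ` e \<in> E)"

definition in_copy :: "'a \<Rightarrow> 'b set \<Rightarrow> 'b set set \<Rightarrow> 'a set \<Rightarrow> 'a set set \<Rightarrow> bool" where
  "in_copy x VF EF V E \<longleftrightarrow> (\<exists>f. is_copy f VF EF V E \<and> x \<in> f ` VF)"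

definition K4m_verts :: "nat set" where
  "K4m_verts = {0, 1, 2, 3}"

definition K4m_edges :: "nat set set" where
  "K4m_edges = {{0, 1, 2}, {0, 1, 3}, {0, 2, 3}}"

definition link_verts :: "'a set \<Rightarrow> 'a \<Rightarrow> 'a set" where
  "link_verts V x = V - {x}"

text \<open>In a 3-graph, \<open>{x, y, z} \<in> E\<close> forces \<open>x\<close>, \<open>y\<close>, \<open>z\<close> to be distinct.\<close>

definition link_edges :: "'a set set \<Rightarrow> 'a \<Rightarrow> 'a set set" where
  "link_edges E x = {{y, z} | y z. {x, y, z} \<in> E}"

definition bipartite :: "'a set \<Rightarrow> 'a set set \<Rightarrow> bool" where
  "bipartite V E \<longleftrightarrow>
     (\<exists>A B. A \<union> B = V \<and> A \<inter> B = {} \<and> (\<forall>e\<in>E. \<exists>a\<in>A. \<exists>b\<in>B. e = {a, b}))"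

definition c_star :: real where
  "c_star = (sqrt 13 - 1) / 6"

end

theory Submission
  imports Defs
begin

text \<open>The link graph \<open>G\<close> of \<open>x\<close> is triangle-free, and an edge of \<open>H\<close> avoiding \<open>x\<close> contains at most
  one edge of \<open>G\<close>. Counting the ordered pairs that this excludes from the link of a vertex \<open>v\<close> gives
  \<open>2 deg\<^sub>H(v) + d(v)\<^sup>2 + 2 (\<Sum>a \<sim> v. d(a)) \<le> n\<^sup>2 + O(n)\<close>, where \<open>d\<close> is the degree in \<open>G\<close>. Summing over
  \<open>v\<close> yields \<open>3 (\<Sum>v. d(v)\<^sup>2) \<le> (1 - c + o(1)) n\<^sup>3\<close>, where \<open>1 - c = 3c\<^sup>2\<close> for \<open>c = c_star\<close>, whereas
  \<open>(\<Sum>v. d(v)) \<ge> (c - o(1)) n\<^sup>2\<close>. This is the equality case of Cauchy--Schwarz, so all but few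
  vertices have degree about \<open>c n\<close>. As \<open>c > 2/5\<close>, deleting the few exceptional vertices leaves a
  triangle-free graph to which the Andrasfai--Erdos--Sos theorem applies.\<close>

subsection \<open>Triangle-free graphs of large minimum degree\<close>

text \<open>Consecutive vertices of the walk have no common neighbour, so any \<open>w\<close> is
  adjacent to at most two of the five. Hence the five degrees into \<open>S\<close> sum to at most
  \<open>2 * card S\<close>, while \<open>deg\<close> makes the sum exceed this.\<close>

lemma no_closed_5_walk:
  fixes adj :: "'a \<Rightarrow> 'a \<Rightarrow> bool"
  assumes fin: "finite S"
    and tf: "\<And>a b c. \<lbrakk>adj a b; adj b c; adj a c\<rbrakk> \<Longrightarrow> False"
    and deg: "\<And>v. v \<in> S \<Longrightarrow> 5 * card {w \<in> S. adj v w} > 2 * card S"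
    and S: "v0 \<in> S" "v1 \<in> S" "v2 \<in> S" "v3 \<in> S" "v4 \<in> S"
    and walk: "adj v0 v1" "adj v1 v2" "adj v2 v3" "adj v3 v4" "adj v0 v4"
  shows False
proof -
  define f where "f v w = (if adj v w then 1 else 0 :: nat)" for v w
  have c: "card {w \<in> S. adj v w} = (\<Sum>w\<in>S. f v w)" for v
    using fin by (simp add: f_def sum.If_cases Int_def)
  have "f v0 w + f v1 w + f v2 w + f v3 w + f v4 w \<le> 2" for w
    using tf[OF walk(1), of w] tf[OF walk(2), of w] tf[OF walk(3), of w]
      tf[OF walk(4), of w] tf[OF walk(5), of w]
    by (auto simp: f_def)
  then have "(\<Sum>w\<in>S. f v0 w + f v1 w + f v2 w + f v3 w + f v4 w) \<le> (\<Sum>w\<in>S. 2)"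
    by (intro sum_mono)
  then show False
    using deg[OF S(1)] deg[OF S(2)] deg[OF S(3)] deg[OF S(4)] deg[OF S(5)]
    by (simp add: c sum.distrib)
qed

text \<open>One side consists of the vertices sharing a neighbour with a fixed vertex \<open>a\<close>: an edge inside it
  closes a 5-walk, and an edge outside it gives, together with \<open>a\<close>, three vertices with disjoint
  neighbourhoods.\<close>

lemma triangle_free_large_degree_bipartite:
  fixes adj :: "'a \<Rightarrow> 'a \<Rightarrow> bool"
  assumes fin: "finite S"
    and sym: "\<And>a b. adj a b \<Longrightarrow> adj b a"
    and tf: "\<And>a b c. \<lbrakk>adj a b; adj b c; adj a c\<rbrakk> \<Longrightarrow> False"
    and deg: "\<And>v. v \<in> S \<Longrightarrow> 5 * card {w \<in> S. adj v w} > 2 * card S"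
  obtains A where "\<And>u v. \<lbrakk>u \<in> S; v \<in> S; adj u v\<rbrakk> \<Longrightarrow> u \<in> A \<longleftrightarrow> v \<notin> A"
proof (cases "S = {}")
  case True
  then show ?thesis using that by blast
next
  case False
  then obtain a where a: "a \<in> S" by blast
  define N where "N v = {w \<in> S. adj v w}" for v
  define A where "A = {b. N a \<inter> N b \<noteq> {}}"
  have finN: "finite (N v)" for v
    using fin by (simp add: N_def)
  have "u \<in> A \<longleftrightarrow> v \<notin> A" if uv: "u \<in> S" "v \<in> S" "adj u v" for u v
  proof (rule ccontr)
    assume "\<not> (u \<in> A \<longleftrightarrow> v \<notin> A)"
    then consider "u \<in> A" "v \<in> A" | "u \<notin> A" "v \<notin> A" by blast
    then show False
    proof cases
      case 1
      then obtain p q where pq: "p \<in> S" "adj a p" "adj u p" "q \<in> S" "adj a q" "adj v q"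
        unfolding A_def N_def by blast
      show False
        by (rule no_closed_5_walk[where adj = adj and S = S and ?v0.0 = a and ?v1.0 = p
              and ?v2.0 = u and ?v3.0 = v and ?v4.0 = q])
          (use fin tf deg a uv pq sym in blast)+
    next
      case 2
      have "N u \<inter> N v = {}"
        using tf uv(3) unfolding N_def by blast
      moreover have "N a \<inter> N u = {}" "N a \<inter> N v = {}"
        using 2 by (auto simp: A_def)
      ultimately have "card (N a \<union> N u \<union> N v) = card (N a) + card (N u) + card (N v)"
        using finN by (simp add: card_Un_disjoint Int_Un_distrib2)
      moreover have "card (N a \<union> N u \<union> N v) \<le> card S"
        by (rule card_mono[OF fin]) (auto simp: N_def)
      ultimately show False
        using deg[OF a] deg[OF uv(1)] deg[OF uv(2)] by (simp add: N_def)
    qed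
  qed
  then show ?thesis by (rule that)
qed

subsection \<open>The link graph of an uncovered vertex\<close>

lemma c_star_quadratic: "1 - c_star = 3 * c_star\<^sup>2"
  by (simp add: c_star_def power2_eq_square field_simps)

text \<open>The lower bound leaves room above 2/5 for two later losses of 1/100 each. The upper
  bound gives 2 c \<le> 1, which controls the cross term of the variance.\<close>

lemma c_star_bounds: "43/100 < c_star" "c_star < 1/2"
proof -
  have "358/100 < sqrt 13" "sqrt 13 < 4"
    by (rule real_less_rsqrt, simp add: power2_eq_square)
       (rule real_less_lsqrt, simp_all)
  then show "43/100 < c_star" "c_star < 1/2" by (simp_all add: c_star_def)
qed

section \<open>Edges and copies in 3-graphs\<close>

lemma three_graph_edgeD:
  assumes "three_graph V E" "{a, b, c} \<in> E"
  shows "a \<in> V" "b \<in> V" "c \<in> V" "a \<noteq> b" "a \<noteq> c" "b \<noteq> c"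
proof -
  have "{a, b, c} \<subseteq> V" "card {a, b, c} = 3"
    using assms unfolding uniform_hypergraph_def by auto
  then show "a \<in> V" "b \<in> V" "c \<in> V" "a \<noteq> b" "a \<noteq> c" "b \<noteq> c"
    by (auto simp: card_insert_if split: if_splits)
qed

text \<open>An edge {v, p, q} arises from exactly the pairs (p, q) and (q, p). Degenerate pairs do
  not occur, since edges have three elements.\<close>

lemma card_ordered_link_pairs:
  assumes H: "three_graph V E"
  shows "card {(a, b). {v, a, b} \<in> E} = 2 * vertex_degree E v"
proof -
  define F where "F e = {(a, b). {v, a, b} = e}" for e
  define Ev where "Ev = {e \<in> E. v \<in> e}"
  have "finite (Pow V)" "Ev \<subseteq> Pow V"
    using H unfolding uniform_hypergraph_def Ev_def by auto
  then have finE: "finite Ev"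
    by (rule rev_finite_subset)
  have F: "finite (F e) \<and> card (F e) = 2" if "e \<in> Ev" for e
  proof -
    have e: "e \<in> E" "v \<in> e" "card e = 3"
      using that H unfolding Ev_def uniform_hypergraph_def by auto
    then have "card (e - {v}) = 2" by simp
    then obtain p q where pq: "e - {v} = {p, q}" "p \<noteq> q"
      by (auto simp: card_2_iff)
    then have "e = {v, p, q}" using e by auto
    have "{v, a, b} = e \<longleftrightarrow> {a, b} = {p, q}" for a b
    proof
      assume ab: "{v, a, b} = e"
      then have "v \<noteq> a" "v \<noteq> b"
        using three_graph_edgeD[OF H, of v a b] e(1) by auto
      then have "{a, b} = e - {v}" using ab by blast
      then show "{a, b} = {p, q}" using pq by simp
    qed (use \<open>e = {v, p, q}\<close> in simp)
    then have "F e = {(p, q), (q, p)}"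
      by (auto simp: F_def doubleton_eq_iff)
    then show ?thesis using pq by simp
  qed
  have "{(a, b). {v, a, b} \<in> E} = (\<Union>e\<in>Ev. F e)"
    by (auto simp: F_def Ev_def)
  moreover have "card (\<Union>e\<in>Ev. F e) = (\<Sum>e\<in>Ev. card (F e))"
    using finE F by (intro card_UN_disjoint) (auto simp: F_def)
  ultimately show ?thesis
    using F by (simp add: vertex_degree_def Ev_def)
qed

text \<open>Here \<open>p\<close> is the vertex common to all three edges and {q, r, s} is the
  triple that may be missing. The three edges together force all four vertices to be distinct, so
  \<open>f\<close> is injective.\<close>

lemma in_copy_K4mI:
  assumes H: "three_graph V E"
    and E: "{p, q, r} \<in> E" "{p, q, s} \<in> E" "{p, r, s} \<in> E"
    and x: "x \<in> {p, q, r, s}"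
  shows "in_copy x K4m_verts K4m_edges V E"
proof -
  define f :: "nat \<Rightarrow> 'a" where "f i = (if i = 0 then p else if i = 1 then q else if i = 2 then r else s)" for i
  have f: "f 0 = p" "f 1 = q" "f (Suc 0) = q" "f 2 = r" "f 3 = s" by (simp_all add: f_def)
  note D = three_graph_edgeD[OF H E(1)] three_graph_edgeD[OF H E(2)] three_graph_edgeD[OF H E(3)]
  have "is_copy f K4m_verts K4m_edges V E"
    using D E unfolding is_copy_def K4m_verts_def K4m_edges_def
    by (auto simp: f inj_on_def)
  moreover have "x \<in> f ` K4m_verts"
    using x by (auto simp: f K4m_verts_def)
  ultimately show ?thesis unfolding in_copy_def by blast
qed

section \<open>Local structure of the link graph and double counting\<close>

locale uncovered_vertex =
  fixes V :: "'a set" and E :: "'a set set" and x :: 'a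
  assumes H: "three_graph V E"
    and uncovered: "\<not> in_copy x K4m_verts K4m_edges V E"
begin

definition adj :: "'a \<Rightarrow> 'a \<Rightarrow> bool" where
  "adj a b \<longleftrightarrow> {x, a, b} \<in> E"

definition nbrs :: "'a \<Rightarrow> 'a set" where
  "nbrs a = {b. adj a b}"

abbreviation W :: "'a set" where
  "W \<equiv> link_verts V x"

lemma finite_W: "finite W"
  using H by (simp add: link_verts_def uniform_hypergraph_def)

lemma adj_sym: "adj a b \<Longrightarrow> adj b a"
  by (simp add: adj_def insert_commute)

lemma adjD:
  assumes "adj a b"
  shows "a \<in> W" "b \<in> W" "a \<noteq> b"
  using three_graph_edgeD[OF H assms[unfolded adj_def]] by (auto simp: link_verts_def)

lemma nbrs_subset: "nbrs a \<subseteq> W"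
  using adjD by (auto simp: nbrs_def)

lemma finite_nbrs: "finite (nbrs a)"
  using finite_subset[OF nbrs_subset finite_W] .

lemma card_nbrs_le: "card (nbrs a) \<le> card W"
  by (rule card_mono[OF finite_W nbrs_subset])

text \<open>A triangle in the link gives a copy in which \<open>x\<close> is the vertex of degree
  three.\<close>

lemma triangle_free:
  assumes "adj a b" "adj b c" "adj a c"
  shows False
  using in_copy_K4mI[OF H, of x a b c] assms uncovered by (simp add: adj_def)

text \<open>Two link edges inside a triple share a vertex, here \<open>v\<close>. Then
  \<open>v\<close> is the vertex of degree three of a copy on {v, a, b, x}.\<close>

lemma edge_one_link_edge:
  assumes "{v, a, b} \<in> E" "adj v a" "adj v b"
  shows False
  using in_copy_K4mI[OF H assms(1), of x x] assms uncovered by (simp add: adj_def insert_commute)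

lemma link_edges_eq: "link_edges E x = {{y, z} | y z. adj y z}"
  by (simp add: link_edges_def adj_def)

lemma sum_nbrs: "(\<Sum>v\<in>W. card (nbrs v)) = 2 * vertex_degree E x"
proof -
  have "{(a, b). {x, a, b} \<in> E} = Sigma W nbrs"
    using adjD by (auto simp: nbrs_def adj_def)
  then show ?thesis
    using card_ordered_link_pairs[OF H, of x] finite_W finite_nbrs
    by (simp add: card_SigmaI)
qed

lemma sum_sum_nbrs: "(\<Sum>v\<in>W. \<Sum>a\<in>nbrs v. card (nbrs a)) = (\<Sum>a\<in>W. (card (nbrs a))\<^sup>2)"
proof -
  have eq: "nbrs v = {a \<in> W. adj v a}" for v
    using nbrs_subset by (auto simp: nbrs_def)
  have "(\<Sum>v\<in>W. \<Sum>a\<in>nbrs v. card (nbrs a)) = (\<Sum>v\<in>W. \<Sum>a | a \<in> W \<and> adj v a. card (nbrs a))"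
    using eq by simp
  also have "\<dots> = (\<Sum>a\<in>W. \<Sum>v | v \<in> W \<and> adj v a. card (nbrs a))"
    by (rule sum.swap_restrict[OF finite_W finite_W])
  also have "\<dots> = (\<Sum>a\<in>W. (card (nbrs a))\<^sup>2)"
  proof (rule sum.cong[OF refl])
    fix a
    have "{v. v \<in> W \<and> adj v a} = nbrs a"
      using adj_sym by (auto simp: eq)
    then show "(\<Sum>v | v \<in> W \<and> adj v a. card (nbrs a)) = (card (nbrs a))\<^sup>2"
      by (simp add: power2_eq_square)
  qed
  finally show ?thesis .
qed

text \<open>Four pairwise disjoint sets are packed into \<open>W \<times> W\<close>: the link pairs
  \<open>P'\<close> of \<open>v\<close> avoiding \<open>x\<close>, the square of
  \<open>nbrs v\<close>, the pairs (a, b) with v ~ a ~ b, and their reversals. A link pair in one of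
  the last three would be an edge containing two link edges; an overlap among those three would be a
  triangle v, a, b in the link of \<open>x\<close>.\<close>

lemma degree_bound:
  "2 * vertex_degree E v + (card (nbrs v))\<^sup>2 + 2 * (\<Sum>a\<in>nbrs v. card (nbrs a))
    \<le> (card W)\<^sup>2 + 2 * card W"
proof -
  define P where "P = {(a, b). {v, a, b} \<in> E}"
  define P' where "P' = P \<inter> W \<times> W"
  define Q where "Q = Sigma (nbrs v) nbrs"
  define Q' where "Q' = prod.swap ` Q"
  \<comment> \<open>Pairs with a coordinate \<open>x\<close> are the only ones lost in
    \<open>P'\<close>; there are at most twice \<open>card (nbrs v)\<close> of them, the source of
    the linear error term.\<close>
  have "P \<subseteq> P' \<union> ({x} \<times> nbrs v \<union> nbrs v \<times> {x})"
  proof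
    fix z assume z: "z \<in> P"
    then obtain a b where ab: "z = (a, b)" "{v, a, b} \<in> E" by (auto simp: P_def)
    have "a \<in> V" "b \<in> V" using three_graph_edgeD[OF H ab(2)] by auto
    moreover have "b \<in> nbrs v" if "a = x"
      using ab(2) that by (simp add: nbrs_def adj_def insert_commute)
    moreover have "a \<in> nbrs v" if "b = x"
      using ab(2) that by (simp add: nbrs_def adj_def insert_commute)
    ultimately show "z \<in> P' \<union> ({x} \<times> nbrs v \<union> nbrs v \<times> {x})"
      using z ab(1) by (auto simp: P'_def link_verts_def)
  qed
  moreover have finP': "finite P'"
    unfolding P'_def using finite_W by blast
  ultimately have "card P \<le> card (P' \<union> ({x} \<times> nbrs v \<union> nbrs v \<times> {x}))"
    using finite_nbrs by (intro card_mono) auto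
  also have "\<dots> \<le> card P' + (card ({x} \<times> nbrs v) + card (nbrs v \<times> {x}))"
    by (meson card_Un_le add_left_mono order_trans)
  finally have P: "card P \<le> card P' + 2 * card W"
    using card_nbrs_le[of v] by (simp add: card_cartesian_product)
  have finQ: "finite Q" "finite Q'"
    using finite_nbrs by (auto simp: Q_def Q'_def)
  have cQ: "card Q = (\<Sum>a\<in>nbrs v. card (nbrs a))"
    unfolding Q_def using finite_nbrs by (simp add: card_SigmaI)
  have cQ': "card Q' = card Q"
    unfolding Q'_def by (intro card_image) simp
  \<comment> \<open>The two link edges va and ab meet in \<open>a\<close>, so \<open>a\<close> takes
    the role of the common vertex.\<close>
  have excl: False if "{v, a, b} \<in> E" "adj v a" "adj a b" for a b
  proof -
    have "{a, v, b} \<in> E" using that(1) by (simp add: insert_commute)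
    then show False using edge_one_link_edge adj_sym that by blast
  qed
  then have "P' \<inter> Q = {}"
    by (auto simp: P'_def P_def Q_def nbrs_def)
  moreover have "P' \<inter> Q' = {}"
  proof -
    have "{v, a, b} \<notin> E" if "adj v b" "adj b a" for a b
      using excl[of b a] that by (auto simp: insert_commute)
    then show ?thesis by (auto simp: P'_def P_def Q_def Q'_def nbrs_def)
  qed
  moreover have "(nbrs v \<times> nbrs v) \<inter> Q = {}" "(nbrs v \<times> nbrs v) \<inter> Q' = {}" "Q \<inter> Q' = {}"
    using triangle_free by (auto simp: Q_def Q'_def nbrs_def)
  moreover have "P' \<inter> (nbrs v \<times> nbrs v) = {}"
    using edge_one_link_edge by (auto simp: P'_def P_def nbrs_def)
  ultimately have "card (P' \<union> (nbrs v \<times> nbrs v) \<union> Q \<union> Q')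
      = card P' + card (nbrs v \<times> nbrs v) + card Q + card Q'"
    using finP' finQ finite_nbrs
    by (simp add: card_Un_disjoint Int_Un_distrib2)
  moreover have "P' \<union> (nbrs v \<times> nbrs v) \<union> Q \<union> Q' \<subseteq> W \<times> W"
    by (auto simp: P'_def Q_def Q'_def dest!: subsetD[OF nbrs_subset])
  then have "card (P' \<union> (nbrs v \<times> nbrs v) \<union> Q \<union> Q') \<le> card (W \<times> W)"
    using finite_W by (intro card_mono) auto
  moreover have "card P = 2 * vertex_degree E v"
    unfolding P_def by (rule card_ordered_link_pairs[OF H])
  ultimately show ?thesis
    using P by (simp add: cQ cQ' card_cartesian_product power2_eq_square)
qed

section \<open>Concentration of the link degrees\<close>

lemma sum_squares_bound:
  "2 * (\<Sum>v\<in>W. vertex_degree E v) + 3 * (\<Sum>v\<in>W. (card (nbrs v))\<^sup>2)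
    \<le> card W * ((card W)\<^sup>2 + 2 * card W)"
proof -
  have "(\<Sum>v\<in>W. 2 * vertex_degree E v + (card (nbrs v))\<^sup>2 + 2 * (\<Sum>a\<in>nbrs v. card (nbrs a)))
      \<le> (\<Sum>v\<in>W. (card W)\<^sup>2 + 2 * card W)"
    by (intro sum_mono degree_bound)
  then show ?thesis
    by (simp add: sum.distrib sum_sum_nbrs flip: sum_distrib_left)
qed

text \<open>After expanding the square, \<open>D2\<close> is at most (c^2 + \<delta>) n^3 and the
  cross term at most (-2 c^2 + \<delta>) n^3. With the constant term c^2 n^3 all main terms
  cancel.\<close>

lemma degree_variance:
  fixes \<delta> :: real
  defines "n \<equiv> card W"
  assumes x: "x \<in> V" and \<delta>: "\<delta> > 0" "1 \<le> \<delta> * n"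
    and deg: "\<And>v. v \<in> V \<Longrightarrow> (c_star - \<delta>) * (real n)\<^sup>2 / 2 \<le> vertex_degree E v"
  shows "(\<Sum>v\<in>W. (card (nbrs v) - c_star * n)\<^sup>2) \<le> 2 * \<delta> * real n ^ 3"
proof -
  define D1 where "D1 = (\<Sum>v\<in>W. real (card (nbrs v)))"
  define D2 where "D2 = (\<Sum>v\<in>W. (real (card (nbrs v)))\<^sup>2)"
  define T where "T = (\<Sum>v\<in>W. real (vertex_degree E v))"
  have c: "3 * c_star\<^sup>2 = 1 - c_star" "0 < c_star" "c_star < 1/2"
    using c_star_quadratic c_star_bounds by simp_all
  have "D1 = 2 * real (vertex_degree E x)"
    unfolding D1_def using arg_cong[OF sum_nbrs, of real] by simp
  then have D1: "(c_star - \<delta>) * (real n)\<^sup>2 \<le> D1"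
    using deg[OF x] by simp
  have "(\<Sum>v\<in>W. (c_star - \<delta>) * (real n)\<^sup>2 / 2) \<le> T"
    unfolding T_def by (intro sum_mono deg) (auto simp: link_verts_def)
  then have T: "(c_star - \<delta>) * real n ^ 3 \<le> 2 * T"
    by (simp add: power2_eq_square power3_eq_cube algebra_simps flip: n_def)
  have "2 * T + 3 * D2 \<le> real n ^ 3 + 2 * (real n)\<^sup>2"
    using of_nat_mono[OF sum_squares_bound, where 'a = real]
    by (simp add: T_def D2_def n_def power2_eq_square power3_eq_cube algebra_simps)
  then have D2: "3 * D2 \<le> (1 - c_star + \<delta>) * real n ^ 3 + 2 * (real n)\<^sup>2"
    using T by (simp add: algebra_simps)
  \<comment> \<open>The assumption 1 \<le> \<delta> n absorbs the lower-order term of the counting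
    bound.\<close>
  have n2: "(real n)\<^sup>2 \<le> \<delta> * real n ^ 3"
    using mult_right_mono[OF \<delta>(2), of "(real n)\<^sup>2"] by (simp add: power2_eq_square power3_eq_cube mult.assoc)
  have "(2 * c_star * n) * ((c_star - \<delta>) * (real n)\<^sup>2) \<le> (2 * c_star * n) * D1"
    using D1 c by (intro mult_left_mono) auto
  then have cD1: "2 * c_star\<^sup>2 * real n ^ 3 - 2 * c_star * (\<delta> * real n ^ 3) \<le> 2 * c_star * n * D1"
    by (simp add: power2_eq_square power3_eq_cube algebra_simps)
  have "2 * c_star * (\<delta> * real n ^ 3) \<le> 1 * (\<delta> * real n ^ 3)"
    using c \<delta> by (intro mult_right_mono) auto
  moreover have "(1 - c_star + \<delta>) * real n ^ 3 = 3 * (c_star\<^sup>2 * real n ^ 3) + \<delta> * real n ^ 3"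
    using c(1) by (simp add: distrib_right flip: mult.assoc)
  moreover have "(\<Sum>v\<in>W. (card (nbrs v) - c_star * n)\<^sup>2)
      = (\<Sum>v\<in>W. (real (card (nbrs v)))\<^sup>2 - 2 * c_star * n * real (card (nbrs v)) + c_star\<^sup>2 * (real n)\<^sup>2)"
    by (intro sum.cong) (auto simp: power2_eq_square algebra_simps)
  then have "(\<Sum>v\<in>W. (card (nbrs v) - c_star * n)\<^sup>2)
      = D2 - 2 * c_star * n * D1 + c_star\<^sup>2 * real n ^ 3"
    by (simp add: D1_def D2_def sum.distrib sum_subtractf sum_distrib_left power2_eq_square
        power3_eq_cube flip: n_def)
  ultimately show ?thesis
    using D2 cD1 n2 by argo
qed

lemma link_nearly_bipartite:
  fixes \<eta> :: real
  defines "n \<equiv> card W"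
  assumes x: "x \<in> V" and \<eta>: "0 < \<eta>" "\<eta> \<le> 1/100" and n: "2 \<le> \<eta> ^ 3 * n"
    and deg: "\<And>v. v \<in> V \<Longrightarrow> (c_star - \<eta> ^ 3 / 2) * (real n)\<^sup>2 / 2 \<le> vertex_degree E v"
  shows "\<exists>R \<subseteq> link_edges E x. card R \<le> \<eta> * (real n)\<^sup>2 \<and> bipartite W (link_edges E x - R)"
proof -
  define B where "B = {v \<in> W. card (nbrs v) < (c_star - \<eta>) * n}"
  define S where "S = W - B"
  define R where "R = {e \<in> link_edges E x. e \<inter> B \<noteq> {}}"
  have npos: "real n > 0"
    using n \<eta> by (cases "n = 0") auto
  have finB: "finite B" and finS: "finite S"
    using finite_W by (auto simp: B_def S_def)
  \<comment> \<open>Chebyshev's inequality: each vertex of \<open>B\<close> contributes at least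
    (\<eta> n)^2 to the variance. The choice \<delta> = \<eta>^3 / 2 turns the variance bound into
    \<eta>^3 n^3, leaving at most \<eta> n bad vertices.\<close>
  have "card B * (\<eta> * n)\<^sup>2 = (\<Sum>v\<in>B. (\<eta> * n)\<^sup>2)" by simp
  also have "\<dots> \<le> (\<Sum>v\<in>B. (card (nbrs v) - c_star * n)\<^sup>2)"
  proof (rule sum_mono)
    fix v assume "v \<in> B"
    then have "\<eta> * n \<le> c_star * n - card (nbrs v)"
      by (simp add: B_def algebra_simps)
    then have "(\<eta> * n)\<^sup>2 \<le> (c_star * n - card (nbrs v))\<^sup>2"
      using \<eta> by (intro power_mono) auto
    then show "(\<eta> * n)\<^sup>2 \<le> (card (nbrs v) - c_star * n)\<^sup>2"
      by (simp add: power2_commute)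
  qed
  also have "\<dots> \<le> (\<Sum>v\<in>W. (card (nbrs v) - c_star * n)\<^sup>2)"
    using finite_W by (intro sum_mono2) (auto simp: B_def)
  also have "\<dots> \<le> 2 * (\<eta> ^ 3 / 2) * real n ^ 3"
    unfolding n_def by (rule degree_variance) (use x \<eta> n deg in \<open>auto simp: n_def\<close>)
  also have "\<dots> = (\<eta> * n) * (\<eta> * n)\<^sup>2"
    by (simp add: power2_eq_square power3_eq_cube)
  finally have cB: "card B \<le> \<eta> * n"
    using \<eta> npos by (simp add: mult_le_cancel_right)
  \<comment> \<open>A vertex of \<open>S\<close> has at least 0.42 n neighbours, of which at most
    0.01 n lie in \<open>B\<close>. The remaining 0.41 n exceed 2/5 of
    \<open>card S\<close>.\<close>
  have "5 * card {w \<in> S. adj v w} > 2 * card S" if v: "v \<in> S" for v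
  proof -
    have "(43/100 - 1/100) * n \<le> (c_star - \<eta>) * n"
      using c_star_bounds \<eta> by (intro mult_right_mono) auto
    also have "\<dots> \<le> card (nbrs v)"
      using v by (auto simp: S_def B_def)
    finally have d: "42/100 * real n \<le> card (nbrs v)" by simp
    have "nbrs v \<subseteq> {w \<in> S. adj v w} \<union> B"
      using nbrs_subset by (auto simp: S_def nbrs_def)
    then have "card (nbrs v) \<le> card ({w \<in> S. adj v w} \<union> B)"
      using finS finB by (intro card_mono) auto
    also have "\<dots> \<le> card {w \<in> S. adj v w} + card B" by (rule card_Un_le)
    finally have "real (card (nbrs v)) \<le> card {w \<in> S. adj v w} + card B" by linarith
    moreover have "card B \<le> 1/100 * real n"
      using cB mult_right_mono[OF \<eta>(2), of n] by simp
    moreover have "card S \<le> n"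
      unfolding n_def S_def using finite_W by (intro card_mono) auto
    ultimately show ?thesis using d npos by linarith
  qed
  then obtain A where A: "\<And>u v. \<lbrakk>u \<in> S; v \<in> S; adj u v\<rbrakk> \<Longrightarrow> u \<in> A \<longleftrightarrow> v \<notin> A"
    using triangle_free_large_degree_bipartite[of S adj] finS adj_sym triangle_free by blast
  have "\<exists>a\<in>W \<inter> A. \<exists>b\<in>W - A. e = {a, b}" if e: "e \<in> link_edges E x - R" for e
  proof -
    obtain y z where yz: "e = {y, z}" "adj y z"
      using e by (auto simp: link_edges_eq)
    then have "y \<in> S" "z \<in> S"
      using e adjD[OF yz(2)] by (auto simp: R_def S_def)
    then have "y \<in> A \<longleftrightarrow> z \<notin> A" using A yz by blast
    then show ?thesis
      using yz adjD[OF yz(2)] by (cases "y \<in> A") (auto simp: insert_commute)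
  qed
  then have "bipartite W (link_edges E x - R)"
    unfolding bipartite_def by (intro exI[of _ "W \<inter> A"] exI[of _ "W - A"]) auto
  moreover have "real (card R) \<le> \<eta> * (real n)\<^sup>2"
  proof -
    \<comment> \<open>Orienting each removed edge to start in \<open>B\<close> bounds their number
      by \<open>card B * n\<close>.\<close>
    have "R \<subseteq> (\<lambda>(y, z). {y, z}) ` (B \<times> W)"
    proof
      fix e assume "e \<in> R"
      then obtain y z where yz: "e = {y, z}" "adj y z" "y \<in> B \<or> z \<in> B"
        by (auto simp: R_def link_edges_eq)
      then have "(y, z) \<in> B \<times> W \<or> (z, y) \<in> B \<times> W" using adjD[OF yz(2)] by auto
      then show "e \<in> (\<lambda>(y, z). {y, z}) ` (B \<times> W)"
        using yz(1) by (force simp: insert_commute)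
    qed
    then have "card R \<le> card (B \<times> W)"
      using finB finite_W by (intro surj_card_le) auto
    then have "real (card R) \<le> card B * real n"
      by (simp add: card_cartesian_product n_def flip: of_nat_mult)
    also have "\<dots> \<le> (\<eta> * n) * n"
      using cB by (intro mult_right_mono) auto
    finally show ?thesis by (simp add: power2_eq_square)
  qed
  ultimately show ?thesis
    by (intro exI[of _ R]) (auto simp: R_def)
qed

end

theorem theorem1p2:
  shows "\<forall>\<epsilon>::real. \<epsilon> > 0 \<longrightarrow>
    (\<exists>(\<delta>::real) (n\<^sub>0::nat). \<delta> > 0 \<and>
      (\<forall>n \<ge> n\<^sub>0. \<forall>(V::'a set) (E::'a set set) (x::'a).
         three_graph V E \<longrightarrow> card V = n + 1 \<longrightarrow>
         real (min_vertex_degree V E) \<ge> (c_star - \<delta>) * (real n)^2 / 2 \<longrightarrow>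
         x \<in> V \<longrightarrow>
         \<not> in_copy x K4m_verts K4m_edges V E \<longrightarrow>
         (\<exists>R \<subseteq> link_edges E x. real (card R) \<le> \<epsilon> * (real n)^2 \<and>
            bipartite (link_verts V x) (link_edges E x - R))))"
proof (intro allI impI)
  fix \<epsilon> :: real assume "\<epsilon> > 0"
  \<comment> \<open>The cap 1/100 preserves the minimum-degree condition for the bipartition;
    \<open>n0\<close> below ensures 2 \<le> \<eta>^3 n, that is, 1 \<le> \<delta> n for \<delta> =
    \<eta>^3 / 2.\<close>
  define \<eta> where "\<eta> = min \<epsilon> (1/100)"
  have \<eta>: "0 < \<eta>" "\<eta> \<le> 1/100" "\<eta> \<le> \<epsilon>"
    using \<open>\<epsilon> > 0\<close> by (auto simp: \<eta>_def)
  define n0 where "n0 = nat \<lceil>2 / \<eta> ^ 3\<rceil>"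
  have "\<exists>R \<subseteq> link_edges E x. real (card R) \<le> \<epsilon> * (real n)^2 \<and>
      bipartite (link_verts V x) (link_edges E x - R)"
    if n: "n \<ge> n0" and H: "three_graph V E" and card: "card V = n + 1"
      and deg: "real (min_vertex_degree V E) \<ge> (c_star - \<eta> ^ 3 / 2) * (real n)^2 / 2"
      and x: "x \<in> V" and unc: "\<not> in_copy x K4m_verts K4m_edges V E"
    for n and V :: "'a set" and E and x
  proof -
    interpret uncovered_vertex V E x
      using H unc by unfold_locales
    have W: "card W = n"
      using x card by (simp add: link_verts_def)
    have "2 / \<eta> ^ 3 \<le> n"
      using n unfolding n0_def by linarith
    then have "2 \<le> \<eta> ^ 3 * n"
      using \<eta> by (simp add: field_simps)
    moreover have "(c_star - \<eta> ^ 3 / 2) * (real n)\<^sup>2 / 2 \<le> vertex_degree E v" if "v \<in> V" for v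
    proof -
      have "finite V" using H by (simp add: uniform_hypergraph_def)
      then have "min_vertex_degree V E \<le> vertex_degree E v"
        unfolding min_vertex_degree_def using that by simp
      then show ?thesis using deg by linarith
    qed
    ultimately obtain R where R: "R \<subseteq> link_edges E x" "card R \<le> \<eta> * (real n)\<^sup>2"
        "bipartite W (link_edges E x - R)"
      using link_nearly_bipartite[of \<eta>] x \<eta> W by auto
    moreover have "\<eta> * (real n)\<^sup>2 \<le> \<epsilon> * (real n)\<^sup>2"
      using \<eta> by (intro mult_right_mono) auto
    ultimately show ?thesis by (intro exI[of _ R]) auto
  qed
  then show "\<exists>(\<delta>::real) (n\<^sub>0::nat). \<delta> > 0 \<and>
      (\<forall>n \<ge> n\<^sub>0. \<forall>(V::'a set) (E::'a set set) (x::'a).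
         three_graph V E \<longrightarrow> card V = n + 1 \<longrightarrow>
         real (min_vertex_degree V E) \<ge> (c_star - \<delta>) * (real n)^2 / 2 \<longrightarrow>
         x \<in> V \<longrightarrow>
         \<not> in_copy x K4m_verts K4m_edges V E \<longrightarrow>
         (\<exists>R \<subseteq> link_edges E x. real (card R) \<le> \<epsilon> * (real n)^2 \<and>
            bipartite (link_verts V x) (link_edges E x - R)))"
    using \<eta> by (intro exI[of _ "\<eta> ^ 3 / 2"] exI[of _ n0]) auto
qed

end
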